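(* Let $s,r\in\mathbb N_+$, and let $(a^{(\ell)}_{ij})_{i,j=1}^s,(b^{(\ell)}_i)_{i=1}^s$ for $\ell=1,2,3,4$ and $(\tilde a^{(\ell)}_{mn})_{m,n=1}^r,(\tilde b^{(\ell)}_m)_{m=1}^r$, $(\bar a^{(\ell)}_{mn})_{m,n=1}^r,(\bar b^{(\ell)}_m)_{m=1}^r$ for $\ell=1,2$ be real coefficients. Consider the partitioned Runge--Kutta method for the stochastic nonlinear Schrödinger equation given, for $i=1,\dots,s$ and $m=1,\dots,r$, by \begin{align*} &Q_i^m=q_i^0+\Delta t\sum_{n=1}^r\tilde a^{(1)}_{nm}\Big(\delta_xV_i^n+\big((P_i^n)^2+(Q_i^n)^2\big)P_i^n\Big)-\Delta W_i^1\sum_{n=1}^r\bar a^{(1)}_{nm}P_i^n,\\ &P_i^m=p_i^0+\Delta t\sum_{n=1}^r\tilde a^{(2)}_{nm}\Big(-\delta_x\mathcal W_i^n-\big((P_i^n)^2+(Q_i^n)^2\big)Q_i^n\Big)+\Delta W_i^1\sum_{n=1}^r\bar a^{(2)}_{nm}Q_i^n,\\ &q_i^1=q_i^0+\Delta t\sum_{m=1}^r\tilde b^{(1)}_m\Big(\delta_xV_i^m+\big((P_i^m)^2+(Q_i^m)^2\big)P_i^m\Big)-\Delta W_i^1\sum_{m=1}^r\bar b^{(1)}_mP_i^m,\\ &p_i^1=p_i^0+\Delta t\sum_{m=1}^r\tilde b^{(2)}_m\Big(-\delta_x\mathcal W_i^m-\big((P_i^m)^2+(Q_i^m)^2\big)Q_i^m\Big)+\Delta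 W_i^1\sum_{m=1}^r\bar b^{(2)}_mQ_i^m,\\ &V_i^m=v_0^m+\Delta x\sum_{j=1}^sa^{(1)}_{ij}\,\delta_xV_j^m,\qquad \mathcal W_i^m=w_0^m+\Delta x\sum_{j=1}^sa^{(2)}_{ij}\,\delta_x\mathcal W_j^m,\\ &P_i^m=p_0^m+\Delta x\sum_{j=1}^sa^{(3)}_{ij}V_j^m,\qquad Q_i^m=q_0^m+\Delta x\sum_{j=1}^sa^{(4)}_{ij}\mathcal W_j^m,\\ &v_1^m=v_0^m+\Delta x\sum_{i=1}^sb^{(1)}_i\,\delta_xV_i^m,\qquad w_1^m=w_0^m+\Delta x\sum_{i=1}^sb^{(2)}_i\,\delta_x\mathcal W_i^m,\\ &p_1^m=p_0^m+\Delta x\sum_{i=1}^sb^{(3)}_iV_i^m,\qquad q_1^m=q_0^m+\Delta x\sum_{i=1}^sb^{(4)}_i\mathcal W_i^m . \end{align*} Suppose that for $1\le i,j\le s$ and $1\le m,n\le r$ \begin{align*} &\tilde a^{(1)}_{mn}\tilde b^{(2)}_n+\tilde b^{(1)}_m\tilde a^{(2)}_{nm}-\tilde b^{(1)}_m\tilde b^{(2)}_n=0,\qquad \bar a^{(1)}_{mn}\tilde b^{(2)}_n+\bar b^{(1)}_m\tilde a^{(2)}_{nm}-\bar b^{(1)}_m\tilde b^{(2)}_n=0,\\ &\tilde a^{(1)}_{mn}\bar b^{(2)}_n+\tilde b^{(1)}_m\bar a^{(2)}_{nm}-\tilde b^{(1)}_m\bar b^{(2)}_n=0,\qquad \bar a^{(1)}_{mn}\bar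 b^{(2)}_n+\bar b^{(1)}_m\bar a^{(2)}_{nm}-\bar b^{(1)}_m\bar b^{(2)}_n=0,\\ &a^{(3)}_{ji}b^{(1)}_j+b^{(3)}_ia^{(1)}_{ij}-b^{(3)}_ib^{(1)}_j=0,\qquad a^{(2)}_{ij}b^{(4)}_i+b^{(2)}_ja^{(4)}_{ji}-b^{(4)}_ib^{(2)}_j=0,\\ &b^{(1)}_i=b^{(2)}_i,\qquad \tilde b^{(1)}_m=\tilde b^{(2)}_m . \end{align*} Then the method possesses, almost surely, the discrete multi-symplectic conservation law $$\sum_{i=1}^sb^{(1)}_i\frac1{\Delta t}\big(\mathrm dq_i^1\wedge\mathrm dp_i^1-\mathrm dq_i^0\wedge\mathrm dp_i^0\big)+\sum_{m=1}^r\tilde b^{(1)}_m\frac1{\Delta x}\big(\mathrm dp_1^m\wedge\mathrm dv_1^m-\mathrm dp_0^m\wedge\mathrm dv_0^m+\mathrm dq_1^m\wedge\mathrm dw_1^m-\mathrm dq_0^m\wedge\mathrm dw_0^m\big)=0 .$$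
   Context: The stochastic nonlinear Schrödinger equation is $\mathbf i\,du+u_{xx}\,dt+|u|^2u\,dt=u\circ dW(t)$; with $u=p+\mathbf iq$, $v=p_x$, $w=q_x$ it reads $dq-v_x\,dt=(p^2+q^2)p\,dt-p\circ dW$, $dp+w_x\,dt=-(p^2+q^2)q\,dt+q\circ dW$, $p_x=v$, $q_x=w$. $W$ is a real $L^2$-valued $Q$-Wiener process with trace-class $Q$. The method treats one space-time cell $[0,\Delta x]\times[0,\Delta t]$. All quantities are real numbers for each realization of the noise. Stage quantities $P_i^m,Q_i^m,V_i^m,\mathcal W_i^m$ approximate $p,q,v,w$ at spatial stage $i$ and temporal stage $m$; $\delta_xV_i^m,\delta_x\mathcal W_i^m$ are the stage quantities discretizing $\partial_xv,\partial_xw$. Superscripts $0,1$ on $p_i,q_i$ refer to times $0,\Delta t$ at spatial stage $i$; subscripts $0,1$ on $p^m,q^m,v^m,w^m$ refer to $x=0,\Delta x$ at temporal stage $m$ (quantities indexed by a spatial stage and by a temporal stage are different families). $\Delta W_i^1$ is the (real-valued) increment of $W$ over $[0,\Delta t]$ at the spatial stage point $i$. $\mathrm d$ (roman) is the exterior derivative: for a fixed realization of the noise, all numerical quantities are regarded as differentiable functions of parameters (e.g. the data), so their differentials satisfy the linearized scheme and noise increments carry no differential. *)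

theory Defs
  imports "HOL-Probability.Probability"
begin

section \<open>Q-Wiener processes with values in \<open>L\<^sup>2\<close>\<close>

text \<open>Elements of \<open>L\<^sup>2\<close> are handled through representatives, so that identities between
  them hold almost everywhere.\<close>

definition L2_fun :: "'x measure \<Rightarrow> ('x \<Rightarrow> real) set" where
  "L2_fun N = {f \<in> borel_measurable N. integrable N (\<lambda>x. (f x)\<^sup>2)}"

definition L2_inner :: "'x measure \<Rightarrow> ('x \<Rightarrow> real) \<Rightarrow> ('x \<Rightarrow> real) \<Rightarrow> real" where
  "L2_inner N f g = (\<integral>x. f x * g x \<partial>N)"

definition L2_orthonormal_basis :: "'x measure \<Rightarrow> (nat \<Rightarrow> 'x \<Rightarrow> real) \<Rightarrow> bool" where
  "L2_orthonormal_basis N e \<longleftrightarrow>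
     (\<forall>k. e k \<in> L2_fun N) \<and>
     (\<forall>j k. L2_inner N (e j) (e k) = (if j = k then 1 else 0)) \<and>
     (\<forall>f \<in> L2_fun N. (\<forall>k. L2_inner N f (e k) = 0) \<longrightarrow> (AE x in N. f x = 0))"

text \<open>Symmetric nonnegative trace-class operators. Boundedness is not listed: it follows from
  symmetry (Hellinger--Toeplitz).\<close>

definition trace_class_covariance ::
    "'x measure \<Rightarrow> (('x \<Rightarrow> real) \<Rightarrow> 'x \<Rightarrow> real) \<Rightarrow> bool" where
  "trace_class_covariance N Qop \<longleftrightarrow>
     (\<forall>f \<in> L2_fun N. Qop f \<in> L2_fun N) \<and>
     (\<forall>f \<in> L2_fun N. \<forall>g \<in> L2_fun N. \<forall>c.
        AE x in N. Qop (\<lambda>y. c * f y + g y) x = c * Qop f x + Qop g x) \<and>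
     (\<forall>f \<in> L2_fun N. \<forall>g \<in> L2_fun N. L2_inner N (Qop f) g = L2_inner N f (Qop g)) \<and>
     (\<forall>f \<in> L2_fun N. 0 \<le> L2_inner N (Qop f) f) \<and>
     (\<exists>e. L2_orthonormal_basis N e \<and> summable (\<lambda>k. L2_inner N (Qop (e k)) (e k)))"

text \<open>The law \<open>N(0, \<sigma>2)\<close>, where \<open>\<sigma>2\<close> is the variance; variance \<open>0\<close> is the Dirac mass at \<open>0\<close>.\<close>

definition centred_gaussian :: "'w measure \<Rightarrow> ('w \<Rightarrow> real) \<Rightarrow> real \<Rightarrow> bool" where
  "centred_gaussian M X \<sigma>2 \<longleftrightarrow>
     (if \<sigma>2 = 0 then X \<in> borel_measurable M \<and> (AE \<omega> in M. X \<omega> = 0)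
      else 0 < \<sigma>2 \<and> distributed M lborel X (normal_density 0 (sqrt \<sigma>2)))"

text \<open>\<open>W t \<omega>\<close> is a representative of the \<open>L\<^sup>2\<close>-valued process at time \<open>t\<close>; joint measurability
  makes the value at every single point of the domain a real random variable. Independence of
  the \<open>L\<^sup>2\<close>-valued increments is expressed by independence of all their scalar projections, one
  test function for each increment.\<close>

definition Q_Wiener_process ::
    "'w measure \<Rightarrow> 'x measure \<Rightarrow> (('x \<Rightarrow> real) \<Rightarrow> 'x \<Rightarrow> real)
       \<Rightarrow> (real \<Rightarrow> 'w \<Rightarrow> 'x \<Rightarrow> real) \<Rightarrow> bool" where
  "Q_Wiener_process M N Qop W \<longleftrightarrow>
     prob_space M \<and> trace_class_covariance N Qop \<and>
     (\<forall>t\<ge>0. (\<lambda>(\<omega>, x). W t \<omega> x) \<in> borel_measurable (M \<Otimes>\<^sub>M N)) \<and>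
     (\<forall>t\<ge>0. \<forall>\<omega> \<in> space M. W t \<omega> \<in> L2_fun N) \<and>
     (AE \<omega> in M. AE x in N. W 0 \<omega> x = 0) \<and>
     (AE \<omega> in M. \<forall>t\<ge>0.
        ((\<lambda>u. \<integral>x. (W u \<omega> x - W t \<omega> x)\<^sup>2 \<partial>N) \<longlongrightarrow> 0) (at t within {0..})) \<and>
     (\<forall>\<tau> h n. 0 \<le> \<tau> 0 \<and> mono \<tau> \<and> (\<forall>k. h k \<in> L2_fun N) \<longrightarrow>
        prob_space.indep_vars M (\<lambda>_. borel)
          (\<lambda>k \<omega>. L2_inner N (\<lambda>x. W (\<tau> (Suc k)) \<omega> x - W (\<tau> k) \<omega> x) (h k)) {..<(n::nat)}) \<and>
     (\<forall>u t. \<forall>h \<in> L2_fun N. 0 \<le> u \<and> u \<le> t \<longrightarrow>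
        centred_gaussian M (\<lambda>\<omega>. L2_inner N (\<lambda>x. W t \<omega> x - W u \<omega> x) h)
          ((t - u) * L2_inner N (Qop h) h))"

section \<open>The partitioned Runge--Kutta scheme on one cell\<close>

text \<open>The numerical values on one cell. Stage quantities take the spatial index \<open>i\<close> first and the
  temporal index \<open>m\<close> second. The fields \<open>q_t0, q_t1, p_t0, p_t1\<close> are the values
  \<open>q\<^sub>i\<^sup>0, q\<^sub>i\<^sup>1, p\<^sub>i\<^sup>0, p\<^sub>i\<^sup>1\<close> at the two times, indexed by the spatial stage \<open>i\<close>; the fields
  \<open>p_x0, p_x1, \<dots>\<close> are the values \<open>p\<^sub>0\<^sup>m, p\<^sub>1\<^sup>m, \<dots>\<close> at the two cell ends, indexed by the
  temporal stage \<open>m\<close>.\<close>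

record cell_values =
  P_st :: "nat \<Rightarrow> nat \<Rightarrow> real"
  Q_st :: "nat \<Rightarrow> nat \<Rightarrow> real"
  V_st :: "nat \<Rightarrow> nat \<Rightarrow> real"
  W_st :: "nat \<Rightarrow> nat \<Rightarrow> real"
  dxV :: "nat \<Rightarrow> nat \<Rightarrow> real"
  dxW :: "nat \<Rightarrow> nat \<Rightarrow> real"
  q_t0 :: "nat \<Rightarrow> real"
  q_t1 :: "nat \<Rightarrow> real"
  p_t0 :: "nat \<Rightarrow> real"
  p_t1 :: "nat \<Rightarrow> real"
  p_x0 :: "nat \<Rightarrow> real"
  p_x1 :: "nat \<Rightarrow> real"
  q_x0 :: "nat \<Rightarrow> real"
  q_x1 :: "nat \<Rightarrow> real"
  v_x0 :: "nat \<Rightarrow> real"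
  v_x1 :: "nat \<Rightarrow> real"
  w_x0 :: "nat \<Rightarrow> real"
  w_x1 :: "nat \<Rightarrow> real"

text \<open>Coefficients: \<open>a l i j\<close>, \<open>b l i\<close> in space; \<open>ta l m n\<close>, \<open>tb l m\<close> (with tilde) for the drift
  and \<open>na l m n\<close>, \<open>nb l m\<close> (with bar) for the noise in time. In the temporal stages the
  matrices enter transposed, as \<open>ta l n m\<close> and \<open>na l n m\<close>. \<open>dW i\<close> is the noise increment at the
  spatial stage point \<open>i\<close>.\<close>

definition prk_scheme ::
    "nat \<Rightarrow> nat
     \<Rightarrow> (nat \<Rightarrow> nat \<Rightarrow> nat \<Rightarrow> real) \<Rightarrow> (nat \<Rightarrow> nat \<Rightarrow> real)
     \<Rightarrow> (nat \<Rightarrow> nat \<Rightarrow> nat \<Rightarrow> real) \<Rightarrow> (nat \<Rightarrow> nat \<Rightarrow> real)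
     \<Rightarrow> (nat \<Rightarrow> nat \<Rightarrow> nat \<Rightarrow> real) \<Rightarrow> (nat \<Rightarrow> nat \<Rightarrow> real)
     \<Rightarrow> real \<Rightarrow> real \<Rightarrow> (nat \<Rightarrow> real) \<Rightarrow> cell_values \<Rightarrow> bool" where
  "prk_scheme s r a b ta tb na nb \<Delta>t \<Delta>x dW y \<longleftrightarrow>
     (\<forall>i \<in> {1..s}. \<forall>m \<in> {1..r}.
        Q_st y i m = q_t0 y i
          + \<Delta>t * (\<Sum>n = 1..r. ta 1 n m * (dxV y i n + ((P_st y i n)\<^sup>2 + (Q_st y i n)\<^sup>2) * P_st y i n))
          - dW i * (\<Sum>n = 1..r. na 1 n m * P_st y i n)
      \<and> P_st y i m = p_t0 y i
          + \<Delta>t * (\<Sum>n = 1..r. ta 2 n m * (- dxW y i n - ((P_st y i n)\<^sup>2 + (Q_st y i n)\<^sup>2) * Q_st y i n))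
          + dW i * (\<Sum>n = 1..r. na 2 n m * Q_st y i n)
      \<and> V_st y i m = v_x0 y m + \<Delta>x * (\<Sum>j = 1..s. a 1 i j * dxV y j m)
      \<and> W_st y i m = w_x0 y m + \<Delta>x * (\<Sum>j = 1..s. a 2 i j * dxW y j m)
      \<and> P_st y i m = p_x0 y m + \<Delta>x * (\<Sum>j = 1..s. a 3 i j * V_st y j m)
      \<and> Q_st y i m = q_x0 y m + \<Delta>x * (\<Sum>j = 1..s. a 4 i j * W_st y j m)) \<and>
     (\<forall>i \<in> {1..s}.
        q_t1 y i = q_t0 y i
          + \<Delta>t * (\<Sum>m = 1..r. tb 1 m * (dxV y i m + ((P_st y i m)\<^sup>2 + (Q_st y i m)\<^sup>2) * P_st y i m))
          - dW i * (\<Sum>m = 1..r. nb 1 m * P_st y i m)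
      \<and> p_t1 y i = p_t0 y i
          + \<Delta>t * (\<Sum>m = 1..r. tb 2 m * (- dxW y i m - ((P_st y i m)\<^sup>2 + (Q_st y i m)\<^sup>2) * Q_st y i m))
          + dW i * (\<Sum>m = 1..r. nb 2 m * Q_st y i m)) \<and>
     (\<forall>m \<in> {1..r}.
        v_x1 y m = v_x0 y m + \<Delta>x * (\<Sum>i = 1..s. b 1 i * dxV y i m)
      \<and> w_x1 y m = w_x0 y m + \<Delta>x * (\<Sum>i = 1..s. b 2 i * dxW y i m)
      \<and> p_x1 y m = p_x0 y m + \<Delta>x * (\<Sum>i = 1..s. b 3 i * V_st y i m)
      \<and> q_x1 y m = q_x0 y m + \<Delta>x * (\<Sum>i = 1..s. b 4 i * W_st y i m))"

section \<open>Dependence on parameters and differentials\<close>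

text \<open>For a fixed realization of the noise the cell values are functions \<open>Y\<close> of a parameter.\<close>

definition cell_differentiable_at ::
    "nat \<Rightarrow> nat \<Rightarrow> ('e::real_normed_vector \<Rightarrow> cell_values) \<Rightarrow> 'e \<Rightarrow> bool" where
  "cell_differentiable_at s r Y z \<longleftrightarrow>
     (\<forall>f \<in> {P_st, Q_st, V_st, W_st, dxV, dxW}. \<forall>i \<in> {1..s}. \<forall>m \<in> {1..r}.
        (\<lambda>z. f (Y z) i m) differentiable (at z)) \<and>
     (\<forall>f \<in> {q_t0, q_t1, p_t0, p_t1}. \<forall>i \<in> {1..s}. (\<lambda>z. f (Y z) i) differentiable (at z)) \<and>
     (\<forall>f \<in> {p_x0, p_x1, q_x0, q_x1, v_x0, v_x1, w_x0, w_x1}. \<forall>m \<in> {1..r}.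
        (\<lambda>z. f (Y z) m) differentiable (at z))"

text \<open>Forms on the parameter space take the base point first, then the tangent vectors.\<close>

definition ext_d :: "('e::real_normed_vector \<Rightarrow> real) \<Rightarrow> 'e \<Rightarrow> 'e \<Rightarrow> real" where
  "ext_d f z = frechet_derivative f (at z)"

definition wedge :: "('e \<Rightarrow> 'e \<Rightarrow> real) \<Rightarrow> ('e \<Rightarrow> 'e \<Rightarrow> real) \<Rightarrow> 'e \<Rightarrow> 'e \<Rightarrow> 'e \<Rightarrow> real"
    (infixl "\<and>\<^sub>d" 75) where
  "(\<alpha> \<and>\<^sub>d \<beta>) z X Y = \<alpha> z X * \<beta> z Y - \<alpha> z Y * \<beta> z X"

definition discrete_multisymplectic_law ::
    "nat \<Rightarrow> nat \<Rightarrow> (nat \<Rightarrow> nat \<Rightarrow> real) \<Rightarrow> (nat \<Rightarrow> nat \<Rightarrow> real) \<Rightarrow> real \<Rightarrow> real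
     \<Rightarrow> ('e::real_normed_vector \<Rightarrow> cell_values) \<Rightarrow> 'e \<Rightarrow> bool" where
  "discrete_multisymplectic_law s r b tb \<Delta>t \<Delta>x Y z \<longleftrightarrow>
     (let d = (\<lambda>f k. ext_d (\<lambda>z. f (Y z) k)) in
      \<forall>X X'.
        (\<Sum>i = 1..s. b 1 i * (1 / \<Delta>t) *
            ((d q_t1 i \<and>\<^sub>d d p_t1 i) z X X' - (d q_t0 i \<and>\<^sub>d d p_t0 i) z X X'))
      + (\<Sum>m = 1..r. tb 1 m * (1 / \<Delta>x) *
            ((d p_x1 m \<and>\<^sub>d d v_x1 m) z X X' - (d p_x0 m \<and>\<^sub>d d v_x0 m) z X X'
             + (d q_x1 m \<and>\<^sub>d d w_x1 m) z X X' - (d q_x0 m \<and>\<^sub>d d w_x0 m) z X X'))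
      = 0)"

end

theory Submission
  imports Defs
begin

text \<open>In both directions the cell update is a partitioned Runge--Kutta step, and the coefficient
  conditions say exactly that such a step obeys a discrete product rule for any bilinear pairing of
  its two components. Pairing by the wedge product turns this into: the temporal jump of
  \<open>dq \<and> dp\<close> at the spatial stage \<open>i\<close> is
  \<open>\<Delta>t \<Sum>\<^sub>m b\<^sub>m (d(\<delta>\<^sub>xV) \<and> dP - dQ \<and> d(\<delta>\<^sub>xW))\<close>, since the noise only contributes
  \<open>dP \<and> dP\<close> and \<open>dQ \<and> dQ\<close> and the cubic term cancels, and the spatial jump of
  \<open>dp \<and> dv + dq \<and> dw\<close> at the temporal stage \<open>m\<close> is
  \<open>\<Delta>x \<Sum>\<^sub>i b\<^sub>i (dP \<and> d(\<delta>\<^sub>xV) + dQ \<and> d(\<delta>\<^sub>xW))\<close>. Weighted and summed over the cell, the two cancel.\<close>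

section \<open>Algebra of partitioned Runge-Kutta steps\<close>

text \<open>The index sets \<open>K\<close> and \<open>L\<close> are kept apart from the stages so that several slopes per stage,
  such as drift and noise, are covered by taking sum types.\<close>

lemma partitioned_RK_product_rule:
  fixes q0 p0 :: "'a::comm_ring"
  assumes q1: "q1 = q0 + (\<Sum>k\<in>K. c k * F k)"
    and p1: "p1 = p0 + (\<Sum>l\<in>L. e l * G l)"
    and Q: "\<And>l. l \<in> L \<Longrightarrow> Q l = q0 + (\<Sum>k\<in>K. A k l * F k)"
    and P: "\<And>k. k \<in> K \<Longrightarrow> P k = p0 + (\<Sum>l\<in>L. E l k * G l)"
    and cond: "\<And>k l. k \<in> K \<Longrightarrow> l \<in> L \<Longrightarrow> A k l * e l + c k * E l k = c k * e l"
  shows "q1 * p1 - q0 * p0 = (\<Sum>l\<in>L. e l * (Q l * G l)) + (\<Sum>k\<in>K. c k * (F k * P k))"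
proof -
  have "(\<Sum>l\<in>L. e l * (Q l * G l))
      = (\<Sum>l\<in>L. q0 * (e l * G l) + (\<Sum>k\<in>K. A k l * e l * (F k * G l)))"
    by (intro sum.cong refl) (simp add: Q algebra_simps sum_distrib_left)
  also have "\<dots> = q0 * (\<Sum>l\<in>L. e l * G l) + (\<Sum>k\<in>K. \<Sum>l\<in>L. A k l * e l * (F k * G l))"
    by (simp add: sum.distrib sum_distrib_left sum.swap[of _ L K])
  finally have 1: "(\<Sum>l\<in>L. e l * (Q l * G l)) = \<dots>" .
  have "(\<Sum>k\<in>K. c k * (F k * P k))
      = (\<Sum>k\<in>K. p0 * (c k * F k) + (\<Sum>l\<in>L. c k * E l k * (F k * G l)))"
    by (intro sum.cong refl) (simp add: P algebra_simps sum_distrib_left)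
  also have "\<dots> = p0 * (\<Sum>k\<in>K. c k * F k) + (\<Sum>k\<in>K. \<Sum>l\<in>L. c k * E l k * (F k * G l))"
    by (simp add: sum.distrib sum_distrib_left)
  finally have 2: "(\<Sum>k\<in>K. c k * (F k * P k)) = \<dots>" .
  \<comment> \<open>This is where the coefficient condition acts: the two double sums merge into the
    product of the two increments, which is exactly the quadratic part of
    \<open>q1 * p1\<close>.\<close>
  have "(\<Sum>k\<in>K. \<Sum>l\<in>L. A k l * e l * (F k * G l)) + (\<Sum>k\<in>K. \<Sum>l\<in>L. c k * E l k * (F k * G l))
      = (\<Sum>k\<in>K. \<Sum>l\<in>L. (A k l * e l + c k * E l k) * (F k * G l))"
    by (simp add: sum.distrib distrib_right)
  also have "\<dots> = (\<Sum>k\<in>K. \<Sum>l\<in>L. (c k * F k) * (e l * G l))"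
    by (intro sum.cong refl) (simp add: cond[symmetric] algebra_simps)
  also have "\<dots> = (\<Sum>k\<in>K. c k * F k) * (\<Sum>l\<in>L. e l * G l)"
    by (simp add: sum_product)
  finally have 3: "(\<Sum>k\<in>K. \<Sum>l\<in>L. A k l * e l * (F k * G l))
      + (\<Sum>k\<in>K. \<Sum>l\<in>L. c k * E l k * (F k * G l)) = \<dots>" .
  have "q1 * p1 - q0 * p0 = q0 * (\<Sum>l\<in>L. e l * G l) + p0 * (\<Sum>k\<in>K. c k * F k)
      + (\<Sum>k\<in>K. c k * F k) * (\<Sum>l\<in>L. e l * G l)"
    by (simp add: q1 p1 algebra_simps)
  then show ?thesis
    unfolding 1 2 3[symmetric] by (simp add: algebra_simps)
qed

text \<open>For fixed tangent vectors the product rule applies to the numbers \<open>p1 z X\<close>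
  and \<open>v1 z X'\<close>. Subtracting the same identity with \<open>X\<close> and
  \<open>X'\<close> interchanged produces the wedges. The slope of \<open>p\<close> is the stage
  value \<open>V\<close> itself, so the terms \<open>V i z X * V i z X'\<close> are symmetric and
  drop out.\<close>

lemma spatial_wedge_jump:
  fixes s :: nat and h :: real and p0 v0 p1 v1 :: "'e \<Rightarrow> 'e \<Rightarrow> real"
  assumes p1: "p1 z = (\<lambda>X. p0 z X + h * (\<Sum>i = 1..s. c i * V i z X))"
    and v1: "v1 z = (\<lambda>X. v0 z X + h * (\<Sum>i = 1..s. e i * D i z X))"
    and P: "\<And>i. i \<in> {1..s} \<Longrightarrow> P i z = (\<lambda>X. p0 z X + h * (\<Sum>j = 1..s. A i j * V j z X))"
    and V: "\<And>i. i \<in> {1..s} \<Longrightarrow> V i z = (\<lambda>X. v0 z X + h * (\<Sum>j = 1..s. E i j * D j z X))"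
    and cond: "\<And>i j. i \<in> {1..s} \<Longrightarrow> j \<in> {1..s} \<Longrightarrow> A j i * e j + c i * E i j = c i * e j"
  shows "(p1 \<and>\<^sub>d v1) z X X' - (p0 \<and>\<^sub>d v0) z X X'
    = h * (\<Sum>i = 1..s. e i * (P i \<and>\<^sub>d D i) z X X')"
proof -
  have prod: "p1 z X * v1 z X' - p0 z X * v0 z X'
      = (\<Sum>i = 1..s. e i * (P i z X * (h * D i z X')))
      + (\<Sum>i = 1..s. c i * (h * V i z X * V i z X'))" for X X'
    \<comment> \<open>The product rule puts the slope index first in \<open>A\<close> and
      \<open>E\<close>, whereas the spatial matrices have the stage index first; hence both are
      transposed.\<close>
    by (rule partitioned_RK_product_rule[where A = "\<lambda>k l. A l k" and E = "\<lambda>l k. E k l", OF _ _ _ _ cond])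
      (simp_all add: p1 v1 P V sum_distrib_left mult_ac)
  show ?thesis
    using prod[of X X'] prod[of X' X]
    by (simp add: wedge_def algebra_simps sum_distrib_left sum.distrib sum_subtractf)
qed

text \<open>Drift and noise count as two kinds of slope of one method, and the four coefficient
  conditions are the four pairings of kinds. The noise slope of each component is a multiple of the
  other component's stage value, so its contributions are symmetric in \<open>X\<close> and
  \<open>X'\<close> and vanish on antisymmetrization, whatever the increment \<open>w\<close>
  is.\<close>

lemma temporal_wedge_jump:
  fixes r :: nat and h w :: real and q0 q1 p0 p1 :: "'e \<Rightarrow> 'e \<Rightarrow> real"
  assumes q1: "q1 z = (\<lambda>X. q0 z X + h * (\<Sum>m = 1..r. tb1 m * F m z X)
                 - w * (\<Sum>m = 1..r. nb1 m * P m z X))"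
    and p1: "p1 z = (\<lambda>X. p0 z X + h * (\<Sum>m = 1..r. tb2 m * G m z X)
                 + w * (\<Sum>m = 1..r. nb2 m * Q m z X))"
    and Q: "\<And>m. m \<in> {1..r} \<Longrightarrow> Q m z = (\<lambda>X. q0 z X + h * (\<Sum>n = 1..r. ta1 n m * F n z X)
                 - w * (\<Sum>n = 1..r. na1 n m * P n z X))"
    and P: "\<And>m. m \<in> {1..r} \<Longrightarrow> P m z = (\<lambda>X. p0 z X + h * (\<Sum>n = 1..r. ta2 n m * G n z X)
                 + w * (\<Sum>n = 1..r. na2 n m * Q n z X))"
    and tt: "\<And>m n. m \<in> {1..r} \<Longrightarrow> n \<in> {1..r} \<Longrightarrow> ta1 m n * tb2 n + tb1 m * ta2 n m = tb1 m * tb2 n"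
    and nt: "\<And>m n. m \<in> {1..r} \<Longrightarrow> n \<in> {1..r} \<Longrightarrow> na1 m n * tb2 n + nb1 m * ta2 n m = nb1 m * tb2 n"
    and tn: "\<And>m n. m \<in> {1..r} \<Longrightarrow> n \<in> {1..r} \<Longrightarrow> ta1 m n * nb2 n + tb1 m * na2 n m = tb1 m * nb2 n"
    and nn: "\<And>m n. m \<in> {1..r} \<Longrightarrow> n \<in> {1..r} \<Longrightarrow> na1 m n * nb2 n + nb1 m * na2 n m = nb1 m * nb2 n"
  shows "(q1 \<and>\<^sub>d p1) z X X' - (q0 \<and>\<^sub>d p0) z X X'
    = h * (\<Sum>m = 1..r. tb2 m * (Q m \<and>\<^sub>d G m) z X X' + tb1 m * (F m \<and>\<^sub>d P m) z X X')"
proof -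
  \<comment> \<open>\<open>Inl m\<close> stands for the drift slope and \<open>Inr m\<close> for the
    noise slope at stage \<open>m\<close>. Both labels share the same stage values \<open>?Q\<close>
    and \<open>?P\<close>; \<open>case_sum id id\<close> forgets the label, and the label of the
    slope alone selects the drift or noise matrix.\<close>
  let ?K = "{1..r} <+> {1..r}"
  let ?c = "case_sum tb1 nb1" and ?e = "case_sum tb2 nb2"
  let ?F = "\<lambda>X. case_sum (\<lambda>m. h * F m z X) (\<lambda>m. - w * P m z X)"
  let ?G = "\<lambda>X. case_sum (\<lambda>m. h * G m z X) (\<lambda>m. w * Q m z X)"
  let ?Q = "\<lambda>X. case_sum (\<lambda>m. Q m z X) (\<lambda>m. Q m z X)"
  let ?P = "\<lambda>X. case_sum (\<lambda>m. P m z X) (\<lambda>m. P m z X)"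
  let ?A = "\<lambda>k l. case_sum (\<lambda>m. ta1 m (case_sum id id l)) (\<lambda>m. na1 m (case_sum id id l)) k"
  let ?E = "\<lambda>l k. case_sum (\<lambda>n. ta2 n (case_sum id id k)) (\<lambda>n. na2 n (case_sum id id k)) l"
  have prod: "q1 z X * p1 z X' - q0 z X * p0 z X'
      = (\<Sum>l\<in>?K. ?e l * (?Q X l * ?G X' l)) + (\<Sum>k\<in>?K. ?c k * (?F X k * ?P X' k))" for X X'
  proof (rule partitioned_RK_product_rule[where A = ?A and E = ?E])
    show "q1 z X = q0 z X + (\<Sum>k\<in>?K. ?c k * ?F X k)"
      by (simp add: q1 sum.Plus sum_distrib_left sum_negf mult_ac)
    show "p1 z X' = p0 z X' + (\<Sum>l\<in>?K. ?e l * ?G X' l)"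
      by (simp add: p1 sum.Plus sum_distrib_left mult_ac)
    show "?Q X l = q0 z X + (\<Sum>k\<in>?K. ?A k l * ?F X k)" if l: "l \<in> ?K" for l
    proof -
      obtain m where "m \<in> {1..r}" "l = Inl m \<or> l = Inr m" using l by blast
      then show ?thesis
        using Q[of m] by (auto simp: sum.Plus sum_distrib_left sum_negf mult_ac)
    qed
    show "?P X' k = p0 z X' + (\<Sum>l\<in>?K. ?E l k * ?G X' l)" if k: "k \<in> ?K" for k
    proof -
      obtain m where "m \<in> {1..r}" "k = Inl m \<or> k = Inr m" using k by blast
      then show ?thesis
        using P[of m] by (auto simp: sum.Plus sum_distrib_left mult_ac)
    qed
    show "?A k l * ?e l + ?c k * ?E l k = ?c k * ?e l" if "k \<in> ?K" "l \<in> ?K" for k l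
      using that tt tn nt nn by auto
  qed
  show ?thesis
    using prod[of X X'] prod[of X' X]
    by (simp add: wedge_def sum.Plus algebra_simps sum_distrib_left sum.distrib sum_subtractf sum_negf)
qed

section \<open>Differentiating identities that hold on an open parameter set\<close>

lemma ext_d_has_derivative:
  "f differentiable (at z) \<Longrightarrow> (f has_derivative ext_d f z) (at z)"
  by (simp add: ext_d_def frechet_derivative_works)

text \<open>A derivative at \<open>z\<close> depends only on the values near \<open>z\<close> and is
  unique. This turns scheme equations valid on \<open>U\<close> into linear relations between
  differentials.\<close>

lemma ext_d_eq_on_open:
  assumes "(g has_derivative g') (at z)" "open U" "z \<in> U" "\<And>y. y \<in> U \<Longrightarrow> f y = g y"
  shows "ext_d f z = g'"
proof -
  have "(f has_derivative g') (at z)"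
    using has_derivative_transform_within_open[OF assms(1-3)] assms(4) by simp
  then show ?thesis
    unfolding ext_d_def by (rule frechet_derivative_at[symmetric])
qed

section \<open>The conservation law for one realization of the noise\<close>

text \<open>With the realization fixed, \<open>dW\<close> is constant in the parameter, so the
  linearized scheme is again a partitioned Runge-Kutta step and both jump formulas apply to the
  differentials.\<close>

lemma prk_scheme_multisymplectic:
  fixes Y :: "'e::real_normed_vector \<Rightarrow> cell_values"
  assumes "\<Delta>t \<noteq> 0" "\<Delta>x \<noteq> 0"
    and U: "open U" "z \<in> U"
    and scheme: "\<And>y. y \<in> U \<Longrightarrow> prk_scheme s r a b ta tb na nb \<Delta>t \<Delta>x dW (Y y)"
    and diff: "cell_differentiable_at s r Y z"
    and tt: "\<And>m n. m \<in> {1..r} \<Longrightarrow> n \<in> {1..r} \<Longrightarrow> ta 1 m n * tb 2 n + tb 1 m * ta 2 n m = tb 1 m * tb 2 n"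
    and nt: "\<And>m n. m \<in> {1..r} \<Longrightarrow> n \<in> {1..r} \<Longrightarrow> na 1 m n * tb 2 n + nb 1 m * ta 2 n m = nb 1 m * tb 2 n"
    and tn: "\<And>m n. m \<in> {1..r} \<Longrightarrow> n \<in> {1..r} \<Longrightarrow> ta 1 m n * nb 2 n + tb 1 m * na 2 n m = tb 1 m * nb 2 n"
    and nn: "\<And>m n. m \<in> {1..r} \<Longrightarrow> n \<in> {1..r} \<Longrightarrow> na 1 m n * nb 2 n + nb 1 m * na 2 n m = nb 1 m * nb 2 n"
    and pv: "\<And>i j. i \<in> {1..s} \<Longrightarrow> j \<in> {1..s} \<Longrightarrow> a 3 j i * b 1 j + b 3 i * a 1 i j = b 3 i * b 1 j"
    and qw: "\<And>i j. i \<in> {1..s} \<Longrightarrow> j \<in> {1..s} \<Longrightarrow> a 4 j i * b 2 j + b 4 i * a 2 i j = b 4 i * b 2 j"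
    and b12: "\<And>i. i \<in> {1..s} \<Longrightarrow> b 1 i = b 2 i"
    and tb12: "\<And>m. m \<in> {1..r} \<Longrightarrow> tb 1 m = tb 2 m"
  shows "discrete_multisymplectic_law s r b tb \<Delta>t \<Delta>x Y z"
proof -
  define d where "d f k = ext_d (\<lambda>z. f (Y z) k)" for f :: "cell_values \<Rightarrow> nat \<Rightarrow> real" and k
  define d2 where "d2 f i m = ext_d (\<lambda>z. f (Y z) i m)"
    for f :: "cell_values \<Rightarrow> nat \<Rightarrow> nat \<Rightarrow> real" and i m
  \<comment> \<open>\<open>dF\<close> and \<open>dG\<close> are the differentials of the two drift
    slopes, with the cubic terms expanded by the chain rule.\<close>
  define dF where "dF i m = (\<lambda>z X. d2 dxV i m z X
      + (3 * (P_st (Y z) i m)\<^sup>2 + (Q_st (Y z) i m)\<^sup>2) * d2 P_st i m z X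
      + 2 * P_st (Y z) i m * Q_st (Y z) i m * d2 Q_st i m z X)" for i m
  define dG where "dG i m = (\<lambda>z X. - d2 dxW i m z X
      - 2 * P_st (Y z) i m * Q_st (Y z) i m * d2 P_st i m z X
      - ((P_st (Y z) i m)\<^sup>2 + 3 * (Q_st (Y z) i m)\<^sup>2) * d2 Q_st i m z X)" for i m
  note st = scheme[unfolded prk_scheme_def, THEN conjunct1, THEN bspec, THEN bspec]
  note tm = scheme[unfolded prk_scheme_def, THEN conjunct2, THEN conjunct1, THEN bspec]
  note sp = scheme[unfolded prk_scheme_def, THEN conjunct2, THEN conjunct2, THEN bspec]
  have D2 [derivative_intros]: "((\<lambda>z. f (Y z) i m) has_derivative d2 f i m z) (at z)"
    if "i \<in> {1..s}" "m \<in> {1..r}" "f \<in> {P_st, Q_st, V_st, W_st, dxV, dxW}" for f i m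
    unfolding d2_def using that diff
    by (intro ext_d_has_derivative) (auto simp: cell_differentiable_at_def)
  have Dt: "((\<lambda>z. f (Y z) i) has_derivative d f i z) (at z)"
    if "i \<in> {1..s}" "f \<in> {q_t0, q_t1, p_t0, p_t1}" for f i
    unfolding d_def using that diff
    by (intro ext_d_has_derivative) (auto simp: cell_differentiable_at_def)
  have Dx: "((\<lambda>z. f (Y z) m) has_derivative d f m z) (at z)"
    if "m \<in> {1..r}" "f \<in> {p_x0, p_x1, q_x0, q_x1, v_x0, v_x1, w_x0, w_x1}" for f m
    unfolding d_def using that diff
    by (intro ext_d_has_derivative) (auto simp: cell_differentiable_at_def)
  have DF: "((\<lambda>z. dxV (Y z) i m + ((P_st (Y z) i m)\<^sup>2 + (Q_st (Y z) i m)\<^sup>2) * P_st (Y z) i m)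
      has_derivative dF i m z) (at z)" if "i \<in> {1..s}" "m \<in> {1..r}" for i m
    unfolding dF_def
    by (rule has_derivative_eq_rhs, (rule derivative_intros that | simp add: that)+)
      (auto simp: fun_eq_iff algebra_simps power2_eq_square)
  have DG: "((\<lambda>z. - dxW (Y z) i m - ((P_st (Y z) i m)\<^sup>2 + (Q_st (Y z) i m)\<^sup>2) * Q_st (Y z) i m)
      has_derivative dG i m z) (at z)" if "i \<in> {1..s}" "m \<in> {1..r}" for i m
    unfolding dG_def
    by (rule has_derivative_eq_rhs, (rule derivative_intros that | simp add: that)+)
      (auto simp: fun_eq_iff algebra_simps power2_eq_square)

  \<comment> \<open>The cubic drift is Hamiltonian with energy \<open>(P^2 + Q^2)^2 / 4\<close>. Its
    mixed second derivative \<open>2 * P * Q\<close> enters \<open>dF\<close> and \<open>dG\<close>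
    with opposite signs, so it cancels; the diagonal terms are wedges of a form with itself.\<close>
  have cubic: "(d2 Q_st i m \<and>\<^sub>d dG i m) z X X' + (dF i m \<and>\<^sub>d d2 P_st i m) z X X'
      = - ((d2 P_st i m \<and>\<^sub>d d2 dxV i m) z X X' + (d2 Q_st i m \<and>\<^sub>d d2 dxW i m) z X X')" for i m X X'
    by (simp add: wedge_def dF_def dG_def algebra_simps)
  \<comment> \<open>One linearization pattern serves temporal stages and end values alike: only the
    weights \<open>\<alpha>\<close>, \<open>\<beta>\<close> and the left-hand side \<open>f\<close>
    change.\<close>
  have lin_t: "ext_d f z = (\<lambda>X. d g i z X + \<Delta>t * (\<Sum>n = 1..r. \<alpha> n * dH n X)
      + w * (\<Sum>n = 1..r. \<beta> n * d2 k i n z X))"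
    if "i \<in> {1..s}" "g \<in> {q_t0, p_t0}" "k \<in> {P_st, Q_st}"
      "\<And>n. n \<in> {1..r} \<Longrightarrow> (H n has_derivative dH n) (at z)"
      "\<And>y. y \<in> U \<Longrightarrow> f y = g (Y y) i + \<Delta>t * (\<Sum>n = 1..r. \<alpha> n * H n y)
         + w * (\<Sum>n = 1..r. \<beta> n * k (Y y) i n)"
    for f g i \<alpha> \<beta> w k H dH
    using that(1-4) by (intro ext_d_eq_on_open[OF _ U that(5)] has_derivative_add
      has_derivative_mult_right has_derivative_sum Dt D2) auto
  \<comment> \<open>The \<open>q\<close> equations subtract their noise term; this is the same
    pattern with \<open>w\<close> negated.\<close>
  have lin_t_diff: "ext_d f z = (\<lambda>X. d g i z X + \<Delta>t * (\<Sum>n = 1..r. \<alpha> n * dH n X)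
      - w * (\<Sum>n = 1..r. \<beta> n * d2 k i n z X))"
    if "i \<in> {1..s}" "g \<in> {q_t0, p_t0}" "k \<in> {P_st, Q_st}"
      "\<And>n. n \<in> {1..r} \<Longrightarrow> (H n has_derivative dH n) (at z)"
      "\<And>y. y \<in> U \<Longrightarrow> f y = g (Y y) i + \<Delta>t * (\<Sum>n = 1..r. \<alpha> n * H n y)
         - w * (\<Sum>n = 1..r. \<beta> n * k (Y y) i n)"
    for f g i \<alpha> \<beta> w k H dH
    using lin_t[of i g k H dH f \<alpha> "- w" \<beta>] that by simp
  have lin_x: "ext_d f z = (\<lambda>X. d g m z X + \<Delta>x * (\<Sum>j = 1..s. \<alpha> j * d2 k j m z X))"
    if "m \<in> {1..r}" "g \<in> {p_x0, q_x0, v_x0, w_x0}" "k \<in> {V_st, W_st, dxV, dxW}"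
      "\<And>y. y \<in> U \<Longrightarrow> f y = g (Y y) m + \<Delta>x * (\<Sum>j = 1..s. \<alpha> j * k (Y y) j m)"
    for f g m \<alpha> k
    using that(1-3) by (intro ext_d_eq_on_open[OF _ U that(4)] has_derivative_add
      has_derivative_mult_right has_derivative_sum Dx D2) auto
  have time: "(d q_t1 i \<and>\<^sub>d d p_t1 i) z X X' - (d q_t0 i \<and>\<^sub>d d p_t0 i) z X X'
      = - \<Delta>t * (\<Sum>m = 1..r. tb 1 m * ((d2 P_st i m \<and>\<^sub>d d2 dxV i m) z X X'
          + (d2 Q_st i m \<and>\<^sub>d d2 dxW i m) z X X'))" if i: "i \<in> {1..s}" for i X X'
  proof -
    have "(d q_t1 i \<and>\<^sub>d d p_t1 i) z X X' - (d q_t0 i \<and>\<^sub>d d p_t0 i) z X X'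
      = \<Delta>t * (\<Sum>m = 1..r. tb 2 m * (d2 Q_st i m \<and>\<^sub>d dG i m) z X X'
          + tb 1 m * (dF i m \<and>\<^sub>d d2 P_st i m) z X X')"
    proof (rule temporal_wedge_jump[where w = "dW i", OF _ _ _ _ tt nt tn nn])
      show "d q_t1 i z = (\<lambda>X. d q_t0 i z X + \<Delta>t * (\<Sum>m = 1..r. tb 1 m * dF i m z X)
          - dW i * (\<Sum>m = 1..r. nb 1 m * d2 P_st i m z X))"
        unfolding d_def[of q_t1]
        by (rule lin_t_diff[OF i], simp, simp, rule DF[OF i], assumption, use i tm in blast)
      show "d p_t1 i z = (\<lambda>X. d p_t0 i z X + \<Delta>t * (\<Sum>m = 1..r. tb 2 m * dG i m z X)
          + dW i * (\<Sum>m = 1..r. nb 2 m * d2 Q_st i m z X))"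
        unfolding d_def[of p_t1]
        by (rule lin_t[OF i], simp, simp, rule DG[OF i], assumption, use i tm in blast)
      show "d2 Q_st i m z = (\<lambda>X. d q_t0 i z X + \<Delta>t * (\<Sum>n = 1..r. ta 1 n m * dF i n z X)
          - dW i * (\<Sum>n = 1..r. na 1 n m * d2 P_st i n z X))" if "m \<in> {1..r}" for m
        unfolding d2_def[of Q_st]
        by (rule lin_t_diff[OF i], simp, simp, rule DF[OF i], assumption, use i that st in blast)
      show "d2 P_st i m z = (\<lambda>X. d p_t0 i z X + \<Delta>t * (\<Sum>n = 1..r. ta 2 n m * dG i n z X)
          + dW i * (\<Sum>n = 1..r. na 2 n m * d2 Q_st i n z X))" if "m \<in> {1..r}" for m
        unfolding d2_def[of P_st]
        by (rule lin_t[OF i], simp, simp, rule DG[OF i], assumption, use i that st in blast)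
    qed
    \<comment> \<open>Equal drift weights put both wedges under one factor, as the cancellation in
      \<open>cubic\<close> requires.\<close>
    also have "\<dots> = \<Delta>t * (\<Sum>m = 1..r. tb 1 m * ((d2 Q_st i m \<and>\<^sub>d dG i m) z X X'
          + (dF i m \<and>\<^sub>d d2 P_st i m) z X X'))"
      by (simp add: tb12[symmetric] distrib_left)
    finally show ?thesis
      unfolding cubic by (simp only: mult_minus_right sum_negf mult_minus_left)
  qed
  have space_pv: "(d p_x1 m \<and>\<^sub>d d v_x1 m) z X X' - (d p_x0 m \<and>\<^sub>d d v_x0 m) z X X'
      = \<Delta>x * (\<Sum>i = 1..s. b 1 i * (d2 P_st i m \<and>\<^sub>d d2 dxV i m) z X X')"
    if m: "m \<in> {1..r}" for m X X'
  proof (rule spatial_wedge_jump[OF _ _ _ _ pv])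
    show "d p_x1 m z = (\<lambda>X. d p_x0 m z X + \<Delta>x * (\<Sum>i = 1..s. b 3 i * d2 V_st i m z X))"
      unfolding d_def[of p_x1]
      by (rule lin_x[OF m], simp, simp, use m sp in blast)
    show "d v_x1 m z = (\<lambda>X. d v_x0 m z X + \<Delta>x * (\<Sum>i = 1..s. b 1 i * d2 dxV i m z X))"
      unfolding d_def[of v_x1]
      by (rule lin_x[OF m], simp, simp, use m sp in blast)
    show "d2 P_st i m z = (\<lambda>X. d p_x0 m z X + \<Delta>x * (\<Sum>j = 1..s. a 3 i j * d2 V_st j m z X))"
      if "i \<in> {1..s}" for i
      unfolding d2_def[of P_st]
      by (rule lin_x[OF m], simp, simp, use m that st in blast)
    show "d2 V_st i m z = (\<lambda>X. d v_x0 m z X + \<Delta>x * (\<Sum>j = 1..s. a 1 i j * d2 dxV j m z X))"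
      if "i \<in> {1..s}" for i
      unfolding d2_def[of V_st]
      by (rule lin_x[OF m], simp, simp, use m that st in blast)
  qed
  \<comment> \<open>The same spatial argument with \<open>q\<close>, \<open>w\<close> in place of
    \<open>p\<close>, \<open>v\<close>; it yields the weight \<open>b 2\<close>, which
    \<open>b12\<close> later identifies with \<open>b 1\<close>.\<close>
  have space_qw: "(d q_x1 m \<and>\<^sub>d d w_x1 m) z X X' - (d q_x0 m \<and>\<^sub>d d w_x0 m) z X X'
      = \<Delta>x * (\<Sum>i = 1..s. b 2 i * (d2 Q_st i m \<and>\<^sub>d d2 dxW i m) z X X')"
    if m: "m \<in> {1..r}" for m X X'
  proof (rule spatial_wedge_jump[OF _ _ _ _ qw])
    show "d q_x1 m z = (\<lambda>X. d q_x0 m z X + \<Delta>x * (\<Sum>i = 1..s. b 4 i * d2 W_st i m z X))"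
      unfolding d_def[of q_x1]
      by (rule lin_x[OF m], simp, simp, use m sp in blast)
    show "d w_x1 m z = (\<lambda>X. d w_x0 m z X + \<Delta>x * (\<Sum>i = 1..s. b 2 i * d2 dxW i m z X))"
      unfolding d_def[of w_x1]
      by (rule lin_x[OF m], simp, simp, use m sp in blast)
    show "d2 Q_st i m z = (\<lambda>X. d q_x0 m z X + \<Delta>x * (\<Sum>j = 1..s. a 4 i j * d2 W_st j m z X))"
      if "i \<in> {1..s}" for i
      unfolding d2_def[of Q_st]
      by (rule lin_x[OF m], simp, simp, use m that st in blast)
    show "d2 W_st i m z = (\<lambda>X. d w_x0 m z X + \<Delta>x * (\<Sum>j = 1..s. a 2 i j * d2 dxW j m z X))"
      if "i \<in> {1..s}" for i
      unfolding d2_def[of W_st]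
      by (rule lin_x[OF m], simp, simp, use m that st in blast)
  qed
  have "(\<Sum>i = 1..s. b 1 i * (1 / \<Delta>t) *
            ((d q_t1 i \<and>\<^sub>d d p_t1 i) z X X' - (d q_t0 i \<and>\<^sub>d d p_t0 i) z X X'))
      + (\<Sum>m = 1..r. tb 1 m * (1 / \<Delta>x) *
            ((d p_x1 m \<and>\<^sub>d d v_x1 m) z X X' - (d p_x0 m \<and>\<^sub>d d v_x0 m) z X X'
             + (d q_x1 m \<and>\<^sub>d d w_x1 m) z X X' - (d q_x0 m \<and>\<^sub>d d w_x0 m) z X X')) = 0"
    (is "?T + ?S = 0") for X X'
  proof -
    \<comment> \<open>This two-form at each stage pair is all that survives in either direction:
      after division by the step sizes, time gives minus its double sum with weights
      \<open>b 1 i * tb 1 m\<close> and space gives plus, up to the order of summation.\<close>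
    let ?\<omega> = "\<lambda>i m. (d2 P_st i m \<and>\<^sub>d d2 dxV i m) z X X' + (d2 Q_st i m \<and>\<^sub>d d2 dxW i m) z X X'"
    have "?T = (\<Sum>i = 1..s. - (\<Sum>m = 1..r. b 1 i * tb 1 m * ?\<omega> i m))"
      using \<open>\<Delta>t \<noteq> 0\<close> by (intro sum.cong refl) (simp add: time sum_distrib_left sum_negf mult.assoc)
    also have "\<dots> = - (\<Sum>m = 1..r. \<Sum>i = 1..s. b 1 i * tb 1 m * ?\<omega> i m)"
      unfolding sum_negf by (subst sum.swap) (rule refl)
    finally have T: "?T = \<dots>" .
    have "(d p_x1 m \<and>\<^sub>d d v_x1 m) z X X' - (d p_x0 m \<and>\<^sub>d d v_x0 m) z X X'
             + (d q_x1 m \<and>\<^sub>d d w_x1 m) z X X' - (d q_x0 m \<and>\<^sub>d d w_x0 m) z X X'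
        = \<Delta>x * (\<Sum>i = 1..s. b 1 i * ?\<omega> i m)" if "m \<in> {1..r}" for m
      using space_pv[OF that, of X X'] space_qw[OF that, of X X']
      by (simp add: b12[symmetric] distrib_left sum.distrib)
    then have "?S = (\<Sum>m = 1..r. \<Sum>i = 1..s. b 1 i * tb 1 m * ?\<omega> i m)"
      using \<open>\<Delta>x \<noteq> 0\<close> by (intro sum.cong refl) (simp add: sum_distrib_left mult_ac)
    with T show ?thesis by simp
  qed
  then show ?thesis
    unfolding discrete_multisymplectic_law_def Let_def d_def by blast
qed

text \<open>The law is pathwise: on the almost sure event where the scheme holds on an open
  parameter set, the cell lemma is applied to each realization, with \<open>dW\<close> the
  increments at the points \<open>\<xi> i\<close>.\<close>

theorem theorem5p3:
  fixes s r :: nat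
    and a :: "nat \<Rightarrow> nat \<Rightarrow> nat \<Rightarrow> real" and b :: "nat \<Rightarrow> nat \<Rightarrow> real"
    and ta :: "nat \<Rightarrow> nat \<Rightarrow> nat \<Rightarrow> real" and tb :: "nat \<Rightarrow> nat \<Rightarrow> real"
    and na :: "nat \<Rightarrow> nat \<Rightarrow> nat \<Rightarrow> real" and nb :: "nat \<Rightarrow> nat \<Rightarrow> real"
    and \<Delta>t \<Delta>x :: real
    and M :: "'w measure" and D :: "real set"
    and Qop :: "(real \<Rightarrow> real) \<Rightarrow> real \<Rightarrow> real"
    and W :: "real \<Rightarrow> 'w \<Rightarrow> real \<Rightarrow> real"
    and \<xi> :: "nat \<Rightarrow> real"
    and U :: "'w \<Rightarrow> 'e::real_normed_vector set"
    and Y :: "'w \<Rightarrow> 'e \<Rightarrow> cell_values"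
  assumes "s \<ge> 1" and "r \<ge> 1" and "\<Delta>t > 0" and "\<Delta>x > 0"
    and "D \<in> sets borel" and "{0..\<Delta>x} \<subseteq> D" and "\<And>i. i \<in> {1..s} \<Longrightarrow> \<xi> i \<in> D"
    and "Q_Wiener_process M (restrict_space lborel D) Qop W"
    and "AE \<omega> in M. open (U \<omega>) \<and>
           (\<forall>z \<in> U \<omega>.
              prk_scheme s r a b ta tb na nb \<Delta>t \<Delta>x (\<lambda>i. W \<Delta>t \<omega> (\<xi> i) - W 0 \<omega> (\<xi> i)) (Y \<omega> z)
              \<and> cell_differentiable_at s r (Y \<omega>) z)"
    and "\<And>m n. m \<in> {1..r} \<Longrightarrow> n \<in> {1..r} \<Longrightarrow>
           ta 1 m n * tb 2 n + tb 1 m * ta 2 n m - tb 1 m * tb 2 n = 0"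
    and "\<And>m n. m \<in> {1..r} \<Longrightarrow> n \<in> {1..r} \<Longrightarrow>
           na 1 m n * tb 2 n + nb 1 m * ta 2 n m - nb 1 m * tb 2 n = 0"
    and "\<And>m n. m \<in> {1..r} \<Longrightarrow> n \<in> {1..r} \<Longrightarrow>
           ta 1 m n * nb 2 n + tb 1 m * na 2 n m - tb 1 m * nb 2 n = 0"
    and "\<And>m n. m \<in> {1..r} \<Longrightarrow> n \<in> {1..r} \<Longrightarrow>
           na 1 m n * nb 2 n + nb 1 m * na 2 n m - nb 1 m * nb 2 n = 0"
    and "\<And>i j. i \<in> {1..s} \<Longrightarrow> j \<in> {1..s} \<Longrightarrow>
           a 3 j i * b 1 j + b 3 i * a 1 i j - b 3 i * b 1 j = 0"
    and "\<And>i j. i \<in> {1..s} \<Longrightarrow> j \<in> {1..s} \<Longrightarrow>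
           a 2 i j * b 4 i + b 2 j * a 4 j i - b 4 i * b 2 j = 0"
    and "\<And>i. i \<in> {1..s} \<Longrightarrow> b 1 i = b 2 i"
    and "\<And>m. m \<in> {1..r} \<Longrightarrow> tb 1 m = tb 2 m"
  shows "AE \<omega> in M. \<forall>z \<in> U \<omega>. discrete_multisymplectic_law s r b tb \<Delta>t \<Delta>x (Y \<omega>) z"
proof -
  have *: "discrete_multisymplectic_law s r b tb \<Delta>t \<Delta>x (Y \<omega>) z"
    if "open (U \<omega>)" "z \<in> U \<omega>"
      and scheme: "\<And>y. y \<in> U \<omega> \<Longrightarrow> prk_scheme s r a b ta tb na nb \<Delta>t \<Delta>x
             (\<lambda>i. W \<Delta>t \<omega> (\<xi> i) - W 0 \<omega> (\<xi> i)) (Y \<omega> y) \<and> cell_differentiable_at s r (Y \<omega>) y" for \<omega> z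
  proof (rule prk_scheme_multisymplectic[OF _ _ that(1,2)])
    show "prk_scheme s r a b ta tb na nb \<Delta>t \<Delta>x (\<lambda>i. W \<Delta>t \<omega> (\<xi> i) - W 0 \<omega> (\<xi> i)) (Y \<omega> y)"
      if "y \<in> U \<omega>" for y
      using scheme[OF that] by blast
    \<comment> \<open>The assumption lists the \<open>a 2\<close> term first; here the pair is
      reordered so that \<open>q\<close> takes the role that \<open>p\<close> has in the other
      spatial condition.\<close>
    show "a 4 j i * b 2 j + b 4 i * a 2 i j = b 4 i * b 2 j" if "i \<in> {1..s}" "j \<in> {1..s}" for i j
      using assms(15)[OF that] by (simp add: algebra_simps)
  qed (use assms(3,4,16,17) assms(10-14)[THEN eq_iff_diff_eq_0[THEN iffD2]] that in simp_all)
  show ?thesis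
    using assms(9) by eventually_elim (use * in blast)
qed

end
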